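(* Let $s,t$ be step sequences over a g-comtrace alphabet $(E,sim,ser,inl)$ such that $ext(G^{\{s\}})\cap ext(G^{\{t\}})\neq\emptyset$. Then $s\equiv t$.
   Context: Relations: for $R$ on $X$, $R^{-1}$ inverse, $R^*=\bigcup_{i\ge0}R^i$ ($R^0=\mathrm{id}_X$), $R\circ S=\{(x,y):\exists z.\,xRz\wedge zSy\}$, $R^{\mathrm{sym}}=R\cup R^{-1}$, $R^{\Cap}=R\cap R^{-1}$, $R^C=(X\times X)\setminus R$. A g-comtrace alphabet is $(E,sim,ser,inl)$ with $E$ finite, $sim,inl\subseteq E\times E$ irreflexive and symmetric, $ser\subseteq sim$, $sim\cap inl=\emptyset$. Steps $\mathbb{S}$: nonempty $A\subseteq E$ with $(a,b)\in sim$ for all distinct $a,b\in A$; step sequences: elements of $\mathbb{S}^*$. $\equiv$ is the reflexive symmetric transitive closure of the pairs $(wAz,wBCz)$ ($A,B,C\in\mathbb{S}$, $A=B\cup C$, $B\times C\subseteq ser$) and $(wABz,wBAz)$ ($A,B\in\mathbb{S}$, $A\times B\subseteq inl$). For $s=A_1\dots A_k$: $\overline{A_i}=\{e^{(m+1)}:e\in A_i\}$ where $m$ is the number of $j<i$ with $e\in A_j$; $\Sigma_s=\bigcup_i\overline{A_i}$ (equal for congruent sequences); $l(e^{(j)})=e$; $pos_s(\alpha)=i$ iff $\alpha\in\overline{A_i}$; $\alpha\lhd_s\beta$ iff $pos_s(\alpha)<pos_s(\beta)$; $\alpha\lhd_s^\frown\beta$ iff $\alpha\ne\beta\wedge pos_s(\alpha)\le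 pos_s(\beta)$. Closures: $(X,R_1,R_2)^\lozenge=(X,\prec_{R_1,R_2},\sqsubset_{R_1,R_2})$ with $\prec_{R_1,R_2}=(R_1\cup R_2)^*\circ R_1\circ(R_1\cup R_2)^*$, $\sqsubset_{R_1,R_2}=(R_1\cup R_2)^*\setminus\mathrm{id}_X$; for $R_3=R_1\cap R_2^*$, $(X,R_1,R_2)^{\bowtie}=(X,(\prec_{R_3,R_2})^{\mathrm{sym}}\cup R_1,\sqsubset_{R_3,R_2})$. On $\Sigma_s$: $\alpha<\!\!>_s\beta$ iff $(l(\alpha),l(\beta))\in inl$; $\alpha\sqsubset_s\beta$ iff $\alpha\lhd_s^\frown\beta$ and $(l(\beta),l(\alpha))\notin ser\cup inl$; $\alpha\prec_s\beta$ iff $\alpha\lhd_s\beta$ and one of: (i) $(l(\alpha),l(\beta))\notin ser\cup inl$; (ii) $(\alpha,\beta)\in<\!\!>_s\cap((\sqsubset_s^* )^{\Cap}\circ(<\!\!>_s)^C\circ(\sqsubset_s^* )^{\Cap})$; (iii) $(l(\alpha),l(\beta))\in ser$ and there are $\delta,\gamma\in\Sigma_s$ with $\delta\lhd_s\gamma$, $(l(\delta),l(\gamma))\notin ser$, $\alpha\sqsubset_s^*\delta\sqsubset_s^*\beta$, $\alpha\sqsubset_s^*\gamma\sqsubset_s^*\beta$. $G^{\{s\}}=(\Sigma_s,\prec_s\cup<\!\!>_s,\prec_s\cup\sqsubset_s)^{\bowtie}$. A stratified order on $X$ is an irreflexive transitive relation $\lhd$ for which $a\simeq b\iff(a=b\vee(\neg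 a\lhd b\wedge\neg b\lhd a))$ is an equivalence; $\alpha\lhd^\frown\beta$ iff $\alpha\ne\beta\wedge\neg(\beta\lhd\alpha)$. For $G=(X,<\!\!>,\sqsubset)$, $ext(G)$ is the set of stratified orders $\lhd$ on $X$ with $\alpha<\!\!>\beta\Rightarrow(\alpha\lhd\beta\vee\beta\lhd\alpha)$ and $\alpha\sqsubset\beta\Rightarrow\alpha\lhd^\frown\beta$. *)

theory Defs
  imports Main
begin

section \<open>Relations on a carrier\<close>

text \<open>Reflexive transitive closure with the zeroth power being the identity on the carrier
  \<open>X\<close> (not on the whole type, as in \<^const>\<open>rtrancl\<close>).\<close>

definition star_on :: "'b set \<Rightarrow> 'b rel \<Rightarrow> 'b rel" where
  "star_on X R = Id_on X \<union> R\<^sup>+"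

definition sym_part :: "'b rel \<Rightarrow> 'b rel" where
  "sym_part R = R \<inter> R\<inverse>"

definition sym_closure :: "'b rel \<Rightarrow> 'b rel" where
  "sym_closure R = R \<union> R\<inverse>"

definition compl_on :: "'b set \<Rightarrow> 'b rel \<Rightarrow> 'b rel" where
  "compl_on X R = X \<times> X - R"


section \<open>Generalised comtraces\<close>

locale g_comtrace_alphabet =
  fixes E :: "'e set" and sim ser inl :: "'e rel"
  assumes finite_E: "finite E"
    and sim_on: "sim \<subseteq> E \<times> E"
    and inl_on: "inl \<subseteq> E \<times> E"
    and irrefl_sim: "irrefl sim"
    and sym_sim: "sym sim"
    and irrefl_inl: "irrefl inl"
    and sym_inl: "sym inl"
    and ser_sub: "ser \<subseteq> sim"
    and sim_inl_disjoint: "sim \<inter> inl = {}"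

definition steps :: "'e set \<Rightarrow> 'e rel \<Rightarrow> 'e set set" where
  "steps E sim = {A. A \<noteq> {} \<and> A \<subseteq> E \<and> (\<forall>a\<in>A. \<forall>b\<in>A. a \<noteq> b \<longrightarrow> (a, b) \<in> sim)}"

definition step_seqs :: "'e set \<Rightarrow> 'e rel \<Rightarrow> 'e set list set" where
  "step_seqs E sim = lists (steps E sim)"

definition basic_pairs :: "'e set \<Rightarrow> 'e rel \<Rightarrow> 'e rel \<Rightarrow> 'e rel \<Rightarrow> 'e set list rel" where
  "basic_pairs E sim ser inl =
    {(w @ [A] @ z, w @ [B, C] @ z) | w z A B C.
       w \<in> step_seqs E sim \<and> z \<in> step_seqs E sim \<and>
       A \<in> steps E sim \<and> B \<in> steps E sim \<and> C \<in> steps E sim \<and>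
       A = B \<union> C \<and> B \<times> C \<subseteq> ser}
    \<union>
    {(w @ [A, B] @ z, w @ [B, A] @ z) | w z A B.
       w \<in> step_seqs E sim \<and> z \<in> step_seqs E sim \<and>
       A \<in> steps E sim \<and> B \<in> steps E sim \<and> A \<times> B \<subseteq> inl}"

definition g_congruence :: "'e set \<Rightarrow> 'e rel \<Rightarrow> 'e rel \<Rightarrow> 'e rel \<Rightarrow> 'e set list rel" where
  "g_congruence E sim ser inl =
    star_on (step_seqs E sim) (sym_closure (basic_pairs E sim ser inl))"


section \<open>Event occurrences of a step sequence\<close>

text \<open>The occurrence \<open>e\<^sup>(\<^sup>j\<^sup>)\<close> is the pair \<open>(e, j)\<close>, so the label map is \<^const>\<open>fst\<close>;
  occurrences are numbered from 1, positions in a sequence (as for \<^const>\<open>nth\<close>) from 0.\<close>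

type_synonym 'e occ = "'e \<times> nat"

definition occ_step :: "'e set list \<Rightarrow> nat \<Rightarrow> 'e occ set" where
  "occ_step s i = {(e, card {j. j < i \<and> e \<in> s ! j} + 1) | e. e \<in> s ! i}"

definition occs :: "'e set list \<Rightarrow> 'e occ set" where
  "occs s = (\<Union>i<length s. occ_step s i)"

definition pos :: "'e set list \<Rightarrow> 'e occ \<Rightarrow> nat" where
  "pos s \<alpha> = (THE i. i < length s \<and> \<alpha> \<in> occ_step s i)"

definition before :: "'e set list \<Rightarrow> 'e occ rel" where
  "before s = {(\<alpha>, \<beta>) \<in> occs s \<times> occs s. pos s \<alpha> < pos s \<beta>}"

definition not_later :: "'e set list \<Rightarrow> 'e occ rel" where
  "not_later s = {(\<alpha>, \<beta>) \<in> occs s \<times> occs s. \<alpha> \<noteq> \<beta> \<and> pos s \<alpha> \<le> pos s \<beta>}"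


section \<open>Relational structures and their closures\<close>

type_synonym 'b rel_structure = "'b set \<times> 'b rel \<times> 'b rel"

definition cl_prec :: "'b set \<Rightarrow> 'b rel \<Rightarrow> 'b rel \<Rightarrow> 'b rel" where
  "cl_prec X R1 R2 = star_on X (R1 \<union> R2) O R1 O star_on X (R1 \<union> R2)"

definition cl_weak :: "'b set \<Rightarrow> 'b rel \<Rightarrow> 'b rel \<Rightarrow> 'b rel" where
  "cl_weak X R1 R2 = star_on X (R1 \<union> R2) - Id_on X"

fun bowtie_closure :: "'b rel_structure \<Rightarrow> 'b rel_structure" where
  "bowtie_closure (X, R1, R2) =
    (let R3 = R1 \<inter> star_on X R2
     in (X, sym_closure (cl_prec X R3 R2) \<union> R1, cl_weak X R3 R2))"


section \<open>The structure defined by a step sequence\<close>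

definition seq_inl :: "'e rel \<Rightarrow> 'e set list \<Rightarrow> 'e occ rel" where
  "seq_inl inl s = {(\<alpha>, \<beta>) \<in> occs s \<times> occs s. (fst \<alpha>, fst \<beta>) \<in> inl}"

definition seq_weak :: "'e rel \<Rightarrow> 'e rel \<Rightarrow> 'e set list \<Rightarrow> 'e occ rel" where
  "seq_weak ser inl s =
    {(\<alpha>, \<beta>). (\<alpha>, \<beta>) \<in> not_later s \<and> (fst \<beta>, fst \<alpha>) \<notin> ser \<union> inl}"

definition seq_prec :: "'e rel \<Rightarrow> 'e rel \<Rightarrow> 'e set list \<Rightarrow> 'e occ rel" where
  "seq_prec ser inl s =
    (let X = occs s; W = star_on X (seq_weak ser inl s); I = seq_inl inl s
     in {(\<alpha>, \<beta>). (\<alpha>, \<beta>) \<in> before s \<and>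
          ((fst \<alpha>, fst \<beta>) \<notin> ser \<union> inl
           \<or> (\<alpha>, \<beta>) \<in> I \<inter> (sym_part W O compl_on X I O sym_part W)
           \<or> (fst \<alpha>, fst \<beta>) \<in> ser \<and>
              (\<exists>\<delta>\<in>X. \<exists>\<gamma>\<in>X. (\<delta>, \<gamma>) \<in> before s \<and> (fst \<delta>, fst \<gamma>) \<notin> ser \<and>
                 (\<alpha>, \<delta>) \<in> W \<and> (\<delta>, \<beta>) \<in> W \<and> (\<alpha>, \<gamma>) \<in> W \<and> (\<gamma>, \<beta>) \<in> W))})"

definition seq_structure :: "'e rel \<Rightarrow> 'e rel \<Rightarrow> 'e set list \<Rightarrow> 'e occ rel_structure" where
  "seq_structure ser inl s =
    bowtie_closure
      (occs s, seq_prec ser inl s \<union> seq_inl inl s, seq_prec ser inl s \<union> seq_weak ser inl s)"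


section \<open>Stratified orders and extensions\<close>

definition stratified_order_on :: "'b set \<Rightarrow> 'b rel \<Rightarrow> bool" where
  "stratified_order_on X P \<longleftrightarrow>
    P \<subseteq> X \<times> X \<and> irrefl P \<and> trans P \<and>
    equiv X {(a, b) \<in> X \<times> X. a = b \<or> (a, b) \<notin> P \<and> (b, a) \<notin> P}"

definition weak_of :: "'b set \<Rightarrow> 'b rel \<Rightarrow> 'b rel" where
  "weak_of X P = {(a, b) \<in> X \<times> X. a \<noteq> b \<and> (b, a) \<notin> P}"

text \<open>An order carries its domain, hence the pairs: the same set of pairs (for instance the
  empty one) may be an order on several domains, and these orders are different.\<close>

fun strat_ext :: "'b rel_structure \<Rightarrow> ('b set \<times> 'b rel) set" where
  "strat_ext (X, R, S) =
    {(Y, P). Y = X \<and> stratified_order_on X P \<and>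
       (\<forall>a b. (a, b) \<in> R \<longrightarrow> (a, b) \<in> P \<or> (b, a) \<in> P) \<and>
       (\<forall>a b. (a, b) \<in> S \<longrightarrow> (a, b) \<in> weak_of X P)}"

end

theory Submission
  imports Defs
begin

text \<open>
  A common extension \<open>P\<close> determines a sequence \<open>u\<close> of label sets (the images of its levels), and it
  suffices that \<open>s\<close> is congruent to \<open>u\<close>, since the same then holds for \<open>t\<close>. The strongly connected
  components of \<open>\<sqsubset>\<^sub>s\<close> lie inside single steps of \<open>s\<close> and inside single levels of \<open>P\<close>, and both \<open>s\<close>
  and \<open>u\<close> can be split, by serialisation, into these components. The two resulting sequences are
  permutations of each other. If two components occur in opposite orders, then no pair of their
  labels violates clause (i) of \<open>\<prec>\<^sub>s\<close> or the definition of \<open>\<sqsubset>\<^sub>s\<close>, so every pair is in \<open>inl\<close> or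
  serialisable in both directions; clause (ii) excludes a mixture of the two. Hence such components
  can be interchanged whenever they are adjacent.
\<close>

section \<open>Sequences of level sets\<close>

text \<open>Only values that \<open>r\<close> attains on \<open>X\<close> are listed, so no level is
  empty and the sequence depends only on how \<open>r\<close> orders \<open>X\<close>; ranks may
  have gaps.\<close>

definition level_seq :: "('b \<Rightarrow> 'a) \<Rightarrow> ('b \<Rightarrow> nat) \<Rightarrow> 'b set \<Rightarrow> 'a set list" where
  "level_seq l r X = map (\<lambda>i. l ` {x \<in> X. r x = i}) (sorted_list_of_set (r ` X))"

lemma level_seq_empty [simp]: "level_seq l r {} = []"
  by (simp add: level_seq_def)

lemma level_seq_const:
  assumes "X \<noteq> {}" and "\<forall>x\<in>X. r x = c"
  shows "level_seq l r X = [l ` X]"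
proof -
  have "r ` X = {c}" and "{x \<in> X. r x = c} = X"
    using assms by auto
  then show ?thesis
    by (simp add: level_seq_def)
qed

lemma level_seq_Un:
  assumes fin: "finite A" "finite B" and less: "\<forall>a\<in>A. \<forall>b\<in>B. r a < r b"
  shows "level_seq l r (A \<union> B) = level_seq l r A @ level_seq l r B"
proof -
  have "sorted_list_of_set (r ` (A \<union> B)) = sorted_list_of_set (r ` A) @ sorted_list_of_set (r ` B)"
    using fin less
    by (intro sorted_distinct_set_unique) (force simp: sorted_append image_Un)+
  moreover have "{x \<in> A \<union> B. r x = i} = {x \<in> A. r x = i}" if "i \<in> r ` A" for i
    using less that by force
  moreover have "{x \<in> A \<union> B. r x = i} = {x \<in> B. r x = i}" if "i \<in> r ` B" for i
    using less that by force
  ultimately show ?thesis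
    using fin by (simp add: level_seq_def)
qed

text \<open>Peeling off the lowest level \<open>Y\<close> follows the decomposition of
  \<open>level_seq\<close> into head and tail.\<close>

lemma level_induct [consumes 1, case_names empty level]:
  fixes r :: "'b \<Rightarrow> nat"
  assumes "finite X" and "P {}"
    and step: "\<And>Y Z c. \<lbrakk>finite Y; finite Z; Y \<noteq> {}; \<forall>y\<in>Y. r y = c; \<forall>z\<in>Z. c < r z; P Z\<rbrakk> \<Longrightarrow> P (Y \<union> Z)"
  shows "P X"
  using \<open>finite X\<close>
proof (induction X rule: finite_psubset_induct)
  case (psubset X)
  show ?case
  proof (cases "X = {}")
    case False
    define c where "c = Min (r ` X)"
    define Y where "Y = {x \<in> X. r x = c}"
    have c: "c \<in> r ` X" "\<forall>x\<in>X. c \<le> r x"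
      using psubset.hyps False by (simp_all add: c_def)
    then have "Y \<noteq> {}" "Y \<subseteq> X"
      by (auto simp: Y_def)
    moreover have "\<forall>z\<in>X - Y. c < r z"
      using c by (auto simp: Y_def order.strict_iff_order)
    moreover have "P (X - Y)"
      using psubset.IH \<open>Y \<noteq> {}\<close> \<open>Y \<subseteq> X\<close> by blast
    ultimately have "P (Y \<union> (X - Y))"
      using psubset.hyps \<open>Y \<subseteq> X\<close> by (intro step [where c = c]) (auto simp: Y_def)
    then show ?thesis
      using \<open>Y \<subseteq> X\<close> by (simp add: Un_absorb1)
  qed (simp add: \<open>P {}\<close>)
qed

section \<open>Numerical ranks for lexicographic orders, preorders and stratified orders\<close>

text \<open>Base-\<open>M\<close> encoding: \<open>r1\<close> is the leading part and
  \<open>r2\<close> the last digit, with \<open>M\<close> above all values of \<open>r2\<close> on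
  \<open>X\<close>.\<close>

lemma ex_lex_rank:
  fixes r1 r2 :: "'b \<Rightarrow> nat"
  assumes "finite X"
  shows "\<exists>r :: 'b \<Rightarrow> nat. \<forall>x\<in>X. \<forall>y\<in>X. r x < r y \<longleftrightarrow> r1 x < r1 y \<or> r1 x = r1 y \<and> r2 x < r2 y"
proof -
  define M where "M = Suc (Max (r2 ` X))"
  have M: "r2 x < M" if "x \<in> X" for x
    using assms that by (simp add: M_def le_imp_less_Suc)
  have less: "r1 x * M + r2 x < r1 y * M + r2 y" if "x \<in> X" "r1 x < r1 y" for x y
  proof -
    have "r1 x * M + r2 x < Suc (r1 x) * M"
      using M [OF that(1)] by simp
    also have "\<dots> \<le> r1 y * M"
      using that(2) by (intro mult_right_mono) auto
    finally show ?thesis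
      by simp
  qed
  show ?thesis
    by (rule exI [of _ "\<lambda>x. r1 x * M + r2 x"]) (metis less add_less_cancel_left less_asym linorder_neqE_nat)
qed

lemma ex_preorder_rank:
  fixes p :: "'b \<Rightarrow> nat"
  assumes fin: "finite X" and refl: "\<forall>x\<in>X. (x, x) \<in> T" and "trans T"
    and mono: "\<forall>(x, y)\<in>T. p x \<le> p y"
  shows "\<exists>f :: 'b \<Rightarrow> nat. \<forall>x\<in>X. \<forall>y\<in>X. (p x < p y \<longrightarrow> f x < f y) \<and> ((x, y) \<in> T \<longrightarrow> f x \<le> f y) \<and>
           (f x = f y \<longrightarrow> (x, y) \<in> T)"
proof -
  \<comment> \<open>Order lexicographically by \<open>p\<close>, the size of the down-set, and an arbitrary numbering of the
    down-sets, which separates the classes that are still tied.\<close>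
  define D where "D = (\<lambda>x. {z \<in> X. (z, x) \<in> T})"
  have D_mono: "D x \<subseteq> D y" if "(x, y) \<in> T" for x y
    using that transD [OF \<open>trans T\<close>] by (auto simp: D_def)
  have D_eq: "(x, y) \<in> T" if "x \<in> X" "D x = D y" for x y
    using that refl by (auto simp: D_def)
  obtain idx :: "'b set \<Rightarrow> nat" where idx: "inj_on idx (D ` X)"
    using fin finite_imp_inj_to_nat_seg [of "D ` X"] by auto
  obtain g :: "'b \<Rightarrow> nat" where
    g: "\<forall>x\<in>X. \<forall>y\<in>X. g x < g y \<longleftrightarrow> card (D x) < card (D y) \<or> card (D x) = card (D y) \<and> idx (D x) < idx (D y)"
    using ex_lex_rank [OF fin, of "\<lambda>x. card (D x)" "\<lambda>x. idx (D x)"] by auto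
  obtain f :: "'b \<Rightarrow> nat" where f: "\<forall>x\<in>X. \<forall>y\<in>X. f x < f y \<longleftrightarrow> p x < p y \<or> p x = p y \<and> g x < g y"
    using ex_lex_rank [OF fin, of p g] by auto
  have "(p x < p y \<longrightarrow> f x < f y) \<and> ((x, y) \<in> T \<longrightarrow> f x \<le> f y) \<and> (f x = f y \<longrightarrow> (x, y) \<in> T)"
    if xy: "x \<in> X" "y \<in> X" for x y
  proof (intro conjI impI)
    show "f x < f y" if "p x < p y"
      using f xy that by blast
    show "f x \<le> f y" if T: "(x, y) \<in> T"
    proof -
      have fin': "finite (D y)"
        using fin by (simp add: D_def)
      \<comment> \<open>A proper inclusion of down-sets shows in the cardinality, and equal
        down-sets have equal \<open>idx\<close>, so \<open>g\<close> respects
        \<open>T\<close>.\<close>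
      have "card (D x) < card (D y) \<or> D x = D y"
        using D_mono [OF T] fin' by (meson psubsetI psubset_card_mono)
      then have "g x \<le> g y"
        using g xy by (metis less_irrefl not_less_iff_gr_or_eq linorder_not_le)
      then show ?thesis
        using f xy mono T by (metis (mono_tags, lifting) case_prodD linorder_not_le)
    qed
    show "(x, y) \<in> T" if "f x = f y"
    proof -
      have "g x = g y"
        using f xy that by (metis less_irrefl linorder_neqE_nat)
      then have "idx (D x) = idx (D y)"
        using g xy by (metis less_irrefl linorder_neqE_nat)
      then show ?thesis
        using idx xy D_eq by (auto dest: inj_onD)
    qed
  qed
  then show ?thesis
    by blast
qed

text \<open>The number of predecessors grows strictly along \<open>P\<close> by transitivity and
  agrees on incomparable elements, so it ranks the levels of \<open>P\<close> in their
  order.\<close>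

lemma stratified_order_rank:
  assumes P: "stratified_order_on X P" and fin: "finite X" and "x \<in> X" "y \<in> X"
  shows "(x, y) \<in> P \<longleftrightarrow> card {z. (z, x) \<in> P} < card {z. (z, y) \<in> P}"
proof -
  have sub: "P \<subseteq> X \<times> X" and ir: "irrefl P" and tr: "trans P"
    and eq: "equiv X {(a, b) \<in> X \<times> X. a = b \<or> (a, b) \<notin> P \<and> (b, a) \<notin> P}" (is "equiv X ?R")
    using P by (auto simp: stratified_order_on_def)
  have fin': "finite {z. (z, b) \<in> P}" for b
    using fin sub by (auto intro: finite_subset [of _ X])
  have less: "card {z. (z, a) \<in> P} < card {z. (z, b) \<in> P}" if "(a, b) \<in> P" for a b
  proof (rule psubset_card_mono [OF fin'])
    show "{z. (z, a) \<in> P} \<subset> {z. (z, b) \<in> P}"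
      using that ir tr by (auto simp: irrefl_def dest: transD)
  qed
  \<comment> \<open>A predecessor \<open>z\<close> of \<open>a\<close> cannot lie above
    \<open>b\<close>, for then \<open>b\<close> would precede \<open>a\<close>. If it did not lie
    below \<open>b\<close> either, \<open>z\<close> and \<open>b\<close> would be equivalent, and
    hence \<open>z\<close> and \<open>a\<close> too.\<close>
  have sub': "{z. (z, a) \<in> P} \<subseteq> {z. (z, b) \<in> P}" if "(a, b) \<in> ?R" for a b
  proof
    fix z assume z: "z \<in> {z. (z, a) \<in> P}"
    show "z \<in> {z. (z, b) \<in> P}"
    proof (rule ccontr)
      assume "z \<notin> {z. (z, b) \<in> P}"
      moreover have "(b, z) \<notin> P"
        using that z tr ir by (auto simp: irrefl_def dest: transD)
      ultimately have "(b, z) \<in> ?R"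
        using that z sub by auto
      then have "(a, z) \<in> ?R"
        using that equiv_def eq by (meson transD equivE)
      then show False
        using z ir by (auto simp: irrefl_def)
    qed
  qed
  have "sym ?R"
    using eq by (simp add: equiv_def)
  show ?thesis
  proof
    assume card: "card {z. (z, x) \<in> P} < card {z. (z, y) \<in> P}"
    show "(x, y) \<in> P"
    proof (rule ccontr)
      assume "(x, y) \<notin> P"
      moreover have "(y, x) \<notin> P"
        using less card by fastforce
      ultimately have "(y, x) \<in> ?R"
        using assms by auto
      then show False
        using card card_mono [OF fin' sub'] by (meson not_less)
    qed
  qed (rule less)
qed


section \<open>The congruence\<close>

context g_comtrace_alphabet
begin

definition cong (infix "\<approx>" 50) where
  "s \<approx> t \<longleftrightarrow> (s, t) \<in> g_congruence E sim ser inl"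

lemma cong_refl: "s \<in> step_seqs E sim \<Longrightarrow> s \<approx> s"
  by (simp add: cong_def g_congruence_def star_on_def Id_on_iff)

lemma cong_trans [trans]: "s \<approx> t \<Longrightarrow> t \<approx> u \<Longrightarrow> s \<approx> u"
  by (auto simp: cong_def g_congruence_def star_on_def dest: trancl_trans)

lemma cong_sym:
  assumes "s \<approx> t"
  shows "t \<approx> s"
proof -
  have "sym ((sym_closure (basic_pairs E sim ser inl))\<^sup>+)"
    by (rule sym_trancl) (auto simp: sym_closure_def sym_def)
  moreover have "s \<in> step_seqs E sim \<and> s = t \<or> (s, t) \<in> (sym_closure (basic_pairs E sim ser inl))\<^sup>+"
    using assms by (auto simp: cong_def g_congruence_def star_on_def)
  ultimately show ?thesis
    unfolding cong_def g_congruence_def star_on_def by (meson Id_onI UnCI symD)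
qed

lemma cong_basic: "(s, t) \<in> basic_pairs E sim ser inl \<Longrightarrow> s \<approx> t"
  by (auto simp: cong_def g_congruence_def star_on_def sym_closure_def)

lemma step_seqs_simps [simp]:
  "[] \<in> step_seqs E sim"
  "A # s \<in> step_seqs E sim \<longleftrightarrow> A \<in> steps E sim \<and> s \<in> step_seqs E sim"
  "s @ t \<in> step_seqs E sim \<longleftrightarrow> s \<in> step_seqs E sim \<and> t \<in> step_seqs E sim"
  by (simp_all add: step_seqs_def)

lemma steps_UnD:
  "A \<union> B \<in> steps E sim \<Longrightarrow> A \<noteq> {} \<Longrightarrow> A \<in> steps E sim"
  "A \<union> B \<in> steps E sim \<Longrightarrow> B \<noteq> {} \<Longrightarrow> B \<in> steps E sim"
  by (auto simp: steps_def)

lemma basic_pairs_context: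
  assumes "(s, t) \<in> basic_pairs E sim ser inl" and wz: "w \<in> step_seqs E sim" "z \<in> step_seqs E sim"
  shows "(w @ s @ z, w @ t @ z) \<in> basic_pairs E sim ser inl"
  using assms(1) unfolding basic_pairs_def
proof (elim UnE CollectE exE conjE)
  fix w' z' A B C
  assume *: "(s, t) = (w' @ [A] @ z', w' @ [B, C] @ z')"
    "w' \<in> step_seqs E sim" "z' \<in> step_seqs E sim"
    "A \<in> steps E sim" "B \<in> steps E sim" "C \<in> steps E sim" "A = B \<union> C" "B \<times> C \<subseteq> ser"
  show "(w @ s @ z, w @ t @ z) \<in> {(w @ [A] @ z, w @ [B, C] @ z) | w z A B C.
       w \<in> step_seqs E sim \<and> z \<in> step_seqs E sim \<and>
       A \<in> steps E sim \<and> B \<in> steps E sim \<and> C \<in> steps E sim \<and>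
       A = B \<union> C \<and> B \<times> C \<subseteq> ser} \<union>
    {(w @ [A, B] @ z, w @ [B, A] @ z) | w z A B.
       w \<in> step_seqs E sim \<and> z \<in> step_seqs E sim \<and>
       A \<in> steps E sim \<and> B \<in> steps E sim \<and> A \<times> B \<subseteq> inl}"
    by (rule UnI1, rule CollectI, rule exI [of _ "w @ w'"], rule exI [of _ "z' @ z"],
        intro exI [of _ A] exI [of _ B] exI [of _ C]) (use * wz in simp)
next
  fix w' z' A B
  assume *: "(s, t) = (w' @ [A, B] @ z', w' @ [B, A] @ z')"
    "w' \<in> step_seqs E sim" "z' \<in> step_seqs E sim"
    "A \<in> steps E sim" "B \<in> steps E sim" "A \<times> B \<subseteq> inl"
  show "(w @ s @ z, w @ t @ z) \<in> {(w @ [A] @ z, w @ [B, C] @ z) | w z A B C.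
       w \<in> step_seqs E sim \<and> z \<in> step_seqs E sim \<and>
       A \<in> steps E sim \<and> B \<in> steps E sim \<and> C \<in> steps E sim \<and>
       A = B \<union> C \<and> B \<times> C \<subseteq> ser} \<union>
    {(w @ [A, B] @ z, w @ [B, A] @ z) | w z A B.
       w \<in> step_seqs E sim \<and> z \<in> step_seqs E sim \<and>
       A \<in> steps E sim \<and> B \<in> steps E sim \<and> A \<times> B \<subseteq> inl}"
    by (rule UnI2, rule CollectI, rule exI [of _ "w @ w'"], rule exI [of _ "z' @ z"],
        intro exI [of _ A] exI [of _ B]) (use * wz in simp)
qed

lemma cong_context:
  assumes "s \<approx> t" and wz: "w \<in> step_seqs E sim" "z \<in> step_seqs E sim"
  shows "w @ s @ z \<approx> w @ t @ z"
proof -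
  have basic: "w @ a @ z \<approx> w @ b @ z" if "(a, b) \<in> sym_closure (basic_pairs E sim ser inl)" for a b
    using that basic_pairs_context [OF _ wz] cong_basic cong_sym
    by (auto simp: sym_closure_def simp del: append_assoc)
  consider "s \<in> step_seqs E sim" "s = t" | "(s, t) \<in> (sym_closure (basic_pairs E sim ser inl))\<^sup>+"
    using assms(1) by (auto simp: cong_def g_congruence_def star_on_def)
  then show ?thesis
  proof cases
    case 1
    then show ?thesis
      using wz by (auto intro: cong_refl)
  next
    case 2
    then show ?thesis
    proof (induction rule: trancl_induct)
      case (base t)
      then show ?case
        by (rule basic)
    next
      case (step t u)
      then show ?case
        using basic cong_trans by blast
    qed
  qed
qed

text \<open>First \<open>s\<close> is replaced with \<open>t\<close> on its right, then
  \<open>t\<close> with \<open>s'\<close> on its left; only these two contexts have to be step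
  sequences.\<close>

lemma cong_append:
  assumes "s \<approx> s'" "t \<approx> t'" "s' \<in> step_seqs E sim" "t \<in> step_seqs E sim"
  shows "s @ t \<approx> s' @ t'"
proof -
  have "s @ t \<approx> s' @ t"
    using cong_context [OF assms(1), of "[]" t] assms(4) by simp
  also have "s' @ t \<approx> s' @ t'"
    using cong_context [OF assms(2), of s' "[]"] assms(3) by simp
  finally show ?thesis .
qed

lemma cong_split:
  assumes "A \<union> B \<in> steps E sim" "A \<noteq> {}" "B \<noteq> {}" "A \<times> B \<subseteq> ser"
  shows "[A \<union> B] \<approx> [A, B]"
proof (rule cong_basic)
  have "([] @ [A \<union> B] @ [], [] @ [A, B] @ []) \<in> basic_pairs E sim ser inl"
    unfolding basic_pairs_def
    by (rule UnI1, rule CollectI, intro exI [of _ "[]"] exI [of _ "A \<union> B"] exI [of _ A] exI [of _ B])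
      (use assms steps_UnD [OF assms(1)] in simp)
  then show "([A \<union> B], [A, B]) \<in> basic_pairs E sim ser inl"
    by simp
qed

text \<open>One inclusion covers both directions for \<open>inl\<close>, which is symmetric;
  \<open>ser\<close> need not be, so both are stated.\<close>

definition swappable :: "'e set \<Rightarrow> 'e set \<Rightarrow> bool" where
  "swappable A B \<longleftrightarrow> A \<times> B \<subseteq> inl \<or> A \<times> B \<subseteq> ser \<and> B \<times> A \<subseteq> ser"

lemma cong_swap:
  assumes "A \<in> steps E sim" "B \<in> steps E sim" "swappable A B"
  shows "[A, B] \<approx> [B, A]"
  using assms(3) unfolding swappable_def
proof
  assume "A \<times> B \<subseteq> inl"
  then have "([] @ [A, B] @ [], [] @ [B, A] @ []) \<in> basic_pairs E sim ser inl"
    unfolding basic_pairs_def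
    by (intro UnI2 CollectI exI [of _ "[]"] exI [of _ A] exI [of _ B]) (use assms in auto)
  then show ?thesis
    using cong_basic by simp
next
  assume *: "A \<times> B \<subseteq> ser \<and> B \<times> A \<subseteq> ser"
  \<comment> \<open>As \<open>ser\<close> is contained in \<open>sim\<close>, the two steps merge
    into one, which can be split in either order.\<close>
  then have "A \<union> B \<in> steps E sim"
    using assms(1,2) ser_sub by (auto simp: steps_def)
  moreover have "A \<noteq> {}" "B \<noteq> {}"
    using assms(1,2) by (auto simp: steps_def)
  ultimately show ?thesis
    using cong_split [of A B] cong_split [of B A] *
    by (metis Un_commute cong_sym cong_trans)
qed

lemma cong_move:
  assumes "A \<in> steps E sim" "s \<in> step_seqs E sim" "\<forall>B\<in>set s. swappable A B"
  shows "[A] @ s \<approx> s @ [A]"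
  using assms(2,3)
proof (induction s)
  case Nil
  then show ?case
    using assms(1) by (simp add: cong_refl)
next
  case (Cons B s)
  have "[A] @ (B # s) = [A, B] @ s"
    by simp
  also have "\<dots> \<approx> [B, A] @ s"
    using Cons.prems assms(1) by (intro cong_append cong_swap cong_refl) auto
  also have "\<dots> = [B] @ ([A] @ s)"
    by simp
  also have "\<dots> \<approx> [B] @ (s @ [A])"
    using Cons.prems assms(1) by (intro cong_append [OF cong_refl Cons.IH]) auto
  finally show ?case
    by simp
qed


section \<open>Congruent level sequences\<close>

text \<open>This is exactly what makes every nonempty level a step. Distinctness is asked of the
  labels because \<open>l\<close> may identify elements of a level.\<close>

definition step_levels :: "('b \<Rightarrow> 'e) \<Rightarrow> ('b \<Rightarrow> nat) \<Rightarrow> 'b set \<Rightarrow> bool" where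
  "step_levels l r X \<longleftrightarrow>
     l ` X \<subseteq> E \<and> (\<forall>x\<in>X. \<forall>y\<in>X. r x = r y \<longrightarrow> l x \<noteq> l y \<longrightarrow> (l x, l y) \<in> sim)"

lemma step_levels_mono: "step_levels l r X \<Longrightarrow> Y \<subseteq> X \<Longrightarrow> step_levels l r Y"
  unfolding step_levels_def by blast

lemma step_levels_level:
  "step_levels l r Y \<Longrightarrow> Y \<noteq> {} \<Longrightarrow> \<forall>y\<in>Y. r y = c \<Longrightarrow> l ` Y \<in> steps E sim"
  by (auto simp: step_levels_def steps_def)

lemma level_seq_in_step_seqs:
  "finite X \<Longrightarrow> step_levels l r X \<Longrightarrow> level_seq l r X \<in> step_seqs E sim"
  by (auto simp: level_seq_def step_seqs_def in_lists_conv_set intro!: step_levels_level elim: step_levels_mono)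

text \<open>The labels of the lowest level are serialisable before all others, so this level is
  split off first; the rest is again a step.\<close>

lemma cong_level_seq_split:
  assumes "finite X" "X \<noteq> {}" "l ` X \<in> steps E sim"
    and "\<forall>x\<in>X. \<forall>y\<in>X. r x < r y \<longrightarrow> (l x, l y) \<in> ser"
  shows "[l ` X] \<approx> level_seq l r X"
  using assms
proof (induction X rule: level_induct [where r = r])
  case (level Y Z c)
  have less: "\<forall>y\<in>Y. \<forall>z\<in>Z. r y < r z"
    using level by auto
  have Y: "level_seq l r Y = [l ` Y]"
    using level by (intro level_seq_const)
  show ?case
  proof (cases "Z = {}")
    case True
    then show ?thesis
      using level.prems Y by (simp add: cong_refl)
  next
    case False
    have steps: "l ` Y \<union> l ` Z \<in> steps E sim"
      using level.prems by (simp add: image_Un)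
    then have Z: "l ` Z \<in> steps E sim" "l ` Y \<in> steps E sim"
      using steps_UnD level.hyps False by blast+
    have "l ` Y \<times> l ` Z \<subseteq> ser"
      using less level.prems by auto
    then have "[l ` Y \<union> l ` Z] \<approx> [l ` Y, l ` Z]"
      using steps level.hyps False by (intro cong_split) auto
    also have "[l ` Y, l ` Z] = [l ` Y] @ [l ` Z]"
      by simp
    also have "\<dots> \<approx> [l ` Y] @ level_seq l r Z"
      using level Z False by (intro cong_append cong_refl) auto
    finally show ?thesis
      using level_seq_Un [OF level.hyps(1,2) less, of l] Y by (simp add: image_Un)
  qed
qed simp

text \<open>The parts of different \<open>r\<close>-levels stay in order under \<open>r'\<close>, so
  each \<open>r\<close>-level is split separately by \<open>cong_level_seq_split\<close>.\<close>

lemma cong_level_seq_refine: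
  assumes "finite X" "step_levels l r X"
    and "\<forall>x\<in>X. \<forall>y\<in>X. r x < r y \<longrightarrow> r' x < r' y"
    and "\<forall>x\<in>X. \<forall>y\<in>X. r x = r y \<longrightarrow> r' x < r' y \<longrightarrow> (l x, l y) \<in> ser"
  shows "level_seq l r X \<approx> level_seq l r' X"
  using assms
proof (induction X rule: level_induct [where r = r])
  case (level Y Z c)
  have less: "\<forall>y\<in>Y. \<forall>z\<in>Z. r y < r z"
    using level by auto
  then have less': "\<forall>y\<in>Y. \<forall>z\<in>Z. r' y < r' z"
    using level.prems by blast
  have levels: "step_levels l r Y" "step_levels l r Z"
    using level.prems by (auto intro: step_levels_mono)
  then have Y: "l ` Y \<in> steps E sim"
    using level step_levels_level by blast
  have "level_seq l r Y = [l ` Y]"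
    using level by (intro level_seq_const)
  moreover have "[l ` Y] \<approx> level_seq l r' Y"
    using level Y by (intro cong_level_seq_split) auto
  \<comment> \<open>The rank \<open>r\<close> is constant on \<open>Y\<close>, so any two distinct
    labels there are in \<open>sim\<close>, whatever \<open>r'\<close> does.\<close>
  moreover have "step_levels l r' Y"
    using levels level.hyps by (simp add: step_levels_def)
  then have "level_seq l r' Y \<in> step_seqs E sim"
    using level by (intro level_seq_in_step_seqs)
  moreover have "level_seq l r Z \<approx> level_seq l r' Z"
    using level levels by auto
  moreover have "level_seq l r Z \<in> step_seqs E sim"
    using level levels by (intro level_seq_in_step_seqs)
  ultimately show ?case
    using level_seq_Un [OF level.hyps(1,2) less, of l] level_seq_Un [OF level.hyps(1,2) less', of l]
      cong_append by metis
qed (simp add: cong_refl)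

text \<open>An insertion sort: by induction the higher levels are brought into the order of
  \<open>r'\<close>, then the lowest one moves right past those that \<open>r'\<close> puts before
  it. Each level it passes forms an inversion with it.\<close>

lemma cong_level_seq_permute:
  assumes "finite X" "step_levels l r X"
    and "\<forall>x\<in>X. \<forall>y\<in>X. r x = r y \<longleftrightarrow> r' x = r' y"
    and "\<forall>x\<in>X. \<forall>y\<in>X. r x < r y \<longrightarrow> r' y < r' x \<longrightarrow>
           swappable (l ` {z \<in> X. r z = r x}) (l ` {z \<in> X. r z = r y})"
  shows "level_seq l r X \<approx> level_seq l r' X"
  using assms
proof (induction X rule: level_induct [where r = r])
  case (level Y Z c)
  obtain y where y: "y \<in> Y"
    using level.hyps by blast
  have less: "\<forall>y\<in>Y. \<forall>z\<in>Z. r y < r z"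
    using level by auto
  have levels: "step_levels l r Y" "step_levels l r Z"
    using level.prems by (auto intro: step_levels_mono)
  then have Y: "l ` Y \<in> steps E sim"
    using level step_levels_level by blast
  have Y_level: "\<forall>x\<in>Y. r' x = r' y"
    using level.hyps(4) level.prems(2) y by (metis UnI1)
  \<comment> \<open>No element of \<open>Z\<close> has rank \<open>r' y\<close>: \<open>r\<close>
    and \<open>r'\<close> have the same ties, and \<open>r\<close> separates \<open>Y\<close> from
    \<open>Z\<close>.\<close>
  define U V where "U = {z \<in> Z. r' z < r' y}" and "V = {z \<in> Z. r' y < r' z}"
  have Z: "Z = U \<union> V"
  proof -
    have "r' z \<noteq> r' y" if "z \<in> Z" for z
      using level.prems(2) less y that by (metis UnCI less_irrefl)
    then show ?thesis
      by (auto simp: U_def V_def nat_neq_iff)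
  qed
  have fin: "finite U" "finite V"
    using level.hyps by (simp_all add: U_def V_def)
  have "step_levels l r' Z"
    using levels(2) level.prems(2) by (simp add: step_levels_def cong: ball_cong)
  then have U_seq: "level_seq l r' U \<in> step_seqs E sim" and V_seq: "level_seq l r' V \<in> step_seqs E sim"
    using fin Z by (auto intro!: level_seq_in_step_seqs elim: step_levels_mono)
  have swap: "\<forall>B\<in>set (level_seq l r' U). swappable (l ` Y) B"
  proof
    fix B assume "B \<in> set (level_seq l r' U)"
    then obtain u where u: "u \<in> U" and B: "B = l ` {x \<in> U. r' x = r' u}"
      using fin by (auto simp: level_seq_def)
    have uZ: "u \<in> Z" "r' u < r' y"
      using u by (auto simp: U_def)
    then have "r' x = r' u \<longleftrightarrow> r x = r u" if "x \<in> Z" for x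
      using level.prems(2) that by blast
    moreover have "r x \<noteq> r u" if "x \<in> Y" for x
      using less uZ that by force
    \<comment> \<open>Membership of \<open>Z\<close> in \<open>U\<close> depends only on
      \<open>r'\<close>, and \<open>Y\<close> does not meet this level, so it is a whole
      \<open>r\<close>-level of \<open>Y \<union> Z\<close>.\<close>
    ultimately have "{x \<in> U. r' x = r' u} = {x \<in> Y \<union> Z. r x = r u}"
      using uZ unfolding U_def by (auto; metis)
    moreover have "Y = {x \<in> Y \<union> Z. r x = r y}"
      using level.hyps y by auto
    moreover have "r y < r u"
      using y less uZ by blast
    then have "swappable (l ` {x \<in> Y \<union> Z. r x = r y}) (l ` {x \<in> Y \<union> Z. r x = r u})"
      using level.prems(3) uZ y by blast
    ultimately show "swappable (l ` Y) B"
      using B by simp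
  qed
  have Z': "level_seq l r' Z = level_seq l r' U @ level_seq l r' V"
    using level_seq_Un [OF fin, of r' l] by (auto simp: Z [symmetric]) (auto simp: U_def V_def)
  have IH: "level_seq l r Z \<approx> level_seq l r' Z"
  proof (rule level.IH)
    show "\<forall>x\<in>Z. \<forall>y\<in>Z. r x < r y \<longrightarrow> r' y < r' x \<longrightarrow>
           swappable (l ` {z \<in> Z. r z = r x}) (l ` {z \<in> Z. r z = r y})"
    proof (intro ballI impI)
      fix x z assume *: "x \<in> Z" "z \<in> Z" "r x < r z" "r' z < r' x"
      then have "{u \<in> Y \<union> Z. r u = r x} = {u \<in> Z. r u = r x}"
        "{u \<in> Y \<union> Z. r u = r z} = {u \<in> Z. r u = r z}"
        using less by force+
      moreover have "swappable (l ` {u \<in> Y \<union> Z. r u = r x}) (l ` {u \<in> Y \<union> Z. r u = r z})"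
        using * level.prems(3) by blast
      ultimately show "swappable (l ` {u \<in> Z. r u = r x}) (l ` {u \<in> Z. r u = r z})"
        by simp
    qed
  qed (use levels level.prems(2) in blast)+
  have "level_seq l r (Y \<union> Z) = level_seq l r Y @ level_seq l r Z"
    using level.hyps less by (intro level_seq_Un)
  also have "level_seq l r Y = [l ` Y]"
    using level.hyps by (intro level_seq_const)
  also have "[l ` Y] @ level_seq l r Z \<approx> [l ` Y] @ level_seq l r' Z"
    using IH Y level.hyps levels by (intro cong_append) (auto intro: cong_refl level_seq_in_step_seqs)
  also have "[l ` Y] @ level_seq l r' Z = ([l ` Y] @ level_seq l r' U) @ level_seq l r' V"
    by (simp add: Z')
  also have "\<dots> \<approx> (level_seq l r' U @ [l ` Y]) @ level_seq l r' V"
    using Y U_seq V_seq swap by (intro cong_append cong_move cong_refl) auto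
  also have "\<dots> = level_seq l r' ((U \<union> Y) \<union> V)"
  proof -
    have "level_seq l r' ((U \<union> Y) \<union> V) = level_seq l r' (U \<union> Y) @ level_seq l r' V"
      using fin level.hyps Y_level by (intro level_seq_Un) (auto simp: U_def V_def)
    also have "level_seq l r' (U \<union> Y) = level_seq l r' U @ level_seq l r' Y"
      using fin level.hyps Y_level by (intro level_seq_Un) (auto simp: U_def)
    also have "level_seq l r' Y = [l ` Y]"
      using level.hyps Y_level by (intro level_seq_const)
    finally show ?thesis
      by simp
  qed
  also have "(U \<union> Y) \<union> V = Y \<union> Z"
    using Z by auto
  finally show ?case .
qed (simp add: cong_refl)


section \<open>Extensions of the structure of a step sequence\<close>

text \<open>If a label recurs in a later step, the earlier step is counted there, so the occurrence
  number is larger. Hence the \<open>THE\<close> in \<open>pos\<close> is well defined.\<close>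

lemma pos_eq:
  assumes "i < length s" "x \<in> occ_step s i"
  shows "pos s x = i"
proof -
  have less: False if ij: "i < j" "x \<in> occ_step s i" "x \<in> occ_step s j" for i j
  proof -
    obtain e where e: "e \<in> s ! i" "card {k. k < i \<and> e \<in> s ! k} = card {k. k < j \<and> e \<in> s ! k}"
      using ij(2,3) by (auto simp: occ_step_def)
    have "{k. k < i \<and> e \<in> s ! k} \<subset> {k. k < j \<and> e \<in> s ! k}"
      using ij(1) e(1) by auto
    then have "card {k. k < i \<and> e \<in> s ! k} < card {k. k < j \<and> e \<in> s ! k}"
      by (intro psubset_card_mono) auto
    then show False
      using e(2) by simp
  qed
  show ?thesis
    unfolding pos_def using assms less by (intro the_equality conjI) (simp_all, metis linorder_neqE_nat)
qed

lemma fst_occ_step: "fst ` occ_step s i = s ! i"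
  by (force simp: occ_step_def)

lemma occ_step_pos: "x \<in> occs s \<Longrightarrow> pos s x < length s \<and> x \<in> occ_step s (pos s x)"
  unfolding occs_def by (metis UN_E lessThan_iff pos_eq)

lemma finite_occs: "s \<in> step_seqs E sim \<Longrightarrow> finite (occs s)"
proof -
  assume "s \<in> step_seqs E sim"
  then have "finite (s ! i)" if "i < length s" for i
    using that finite_E by (auto simp: step_seqs_def steps_def in_lists_conv_set all_set_conv_all_nth intro: finite_subset)
  then show "finite (occs s)"
    by (simp add: occs_def occ_step_def)
qed

lemma step_levels_pos:
  assumes "s \<in> step_seqs E sim"
  shows "step_levels fst (pos s) (occs s)"
proof -
  have step: "s ! pos s x \<in> steps E sim" and mem: "fst x \<in> s ! pos s x" if "x \<in> occs s" for x
  proof -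
    show "s ! pos s x \<in> steps E sim"
      using occ_step_pos [OF that] assms by (simp add: step_seqs_def in_lists_conv_set)
    have "fst x \<in> fst ` occ_step s (pos s x)"
      using occ_step_pos [OF that] by (intro imageI) simp
    then show "fst x \<in> s ! pos s x"
      by (simp only: fst_occ_step)
  qed
  show ?thesis
    unfolding step_levels_def
  proof (intro conjI ballI impI)
    show "fst ` occs s \<subseteq> E"
      using step mem unfolding steps_def by blast
    fix x y assume "x \<in> occs s" "y \<in> occs s" "pos s x = pos s y" "fst x \<noteq> fst y"
    then show "(fst x, fst y) \<in> sim"
      using step [of x] mem [of x] mem [of y] by (simp add: steps_def)
  qed
qed

text \<open>Since no step is empty, \<open>pos s\<close> attains every index below
  \<open>length s\<close>, and its levels are the occurrence sets of the steps.\<close>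

lemma level_seq_pos:
  assumes "s \<in> step_seqs E sim"
  shows "level_seq fst (pos s) (occs s) = s"
proof -
  have level: "{x \<in> occs s. pos s x = i} = occ_step s i" if "i < length s" for i
  proof
    show "{x \<in> occs s. pos s x = i} \<subseteq> occ_step s i"
      using occ_step_pos by blast
    show "occ_step s i \<subseteq> {x \<in> occs s. pos s x = i}"
      using that pos_eq by (auto simp: occs_def)
  qed
  have "s ! i \<noteq> {}" if "i < length s" for i
    using that assms by (auto simp: step_seqs_def steps_def)
  then have nonempty: "occ_step s i \<noteq> {}" if "i < length s" for i
    using that fst_occ_step by (metis image_empty)
  have "i \<in> pos s ` occs s" if "i < length s" for i
  proof -
    obtain x where "x \<in> occ_step s i"
      using nonempty \<open>i < length s\<close> by blast
    then have "x \<in> {x \<in> occs s. pos s x = i}"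
      using level [OF that] by simp
    then show ?thesis
      by blast
  qed
  then have "pos s ` occs s = {..<length s}"
    using occ_step_pos by blast
  then have "level_seq fst (pos s) (occs s) = map (\<lambda>i. fst ` {x \<in> occs s. pos s x = i}) [0..<length s]"
    by (simp add: level_seq_def lessThan_atLeast0)
  also have "\<dots> = map (\<lambda>i. s ! i) [0..<length s]"
    by (intro map_cong) (simp_all add: level fst_occ_step)
  finally show ?thesis
    by (simp add: map_nth)
qed

section \<open>From extensions to congruence\<close>

text \<open>The closure contains both generating relations. A pair of \<open>seq_prec\<close> lies
  in both, so it is comparable in \<open>P\<close> and not reversed.\<close>

lemma strat_ext_seq_structureD:
  assumes "(X, P) \<in> strat_ext (seq_structure ser inl s)"
  shows "X = occs s" "stratified_order_on X P"
    "(x, y) \<in> seq_inl inl s \<Longrightarrow> (x, y) \<in> P \<or> (y, x) \<in> P"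
    "(x, y) \<in> seq_weak ser inl s \<Longrightarrow> (y, x) \<notin> P"
    "(x, y) \<in> seq_prec ser inl s \<Longrightarrow> (x, y) \<in> P"
proof -
  define R1 where "R1 = seq_prec ser inl s \<union> seq_inl inl s"
  define R2 where "R2 = seq_prec ser inl s \<union> seq_weak ser inl s"
  define R3 where "R3 = R1 \<inter> star_on (occs s) R2"
  have ext: "(X, P) \<in> strat_ext (occs s, sym_closure (cl_prec (occs s) R3 R2) \<union> R1, cl_weak (occs s) R3 R2)"
    using assms by (simp add: seq_structure_def R1_def R2_def R3_def Let_def)
  show "X = occs s" and "stratified_order_on X P"
    using ext by auto
  have R1: "(x, y) \<in> R1 \<Longrightarrow> (x, y) \<in> P \<or> (y, x) \<in> P" for x y
    using ext by (auto simp del: split_paired_All)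
  have R2: "(y, x) \<notin> P" if "(x, y) \<in> R2" for x y
  proof -
    \<comment> \<open>Irreflexivity matters because \<open>cl_weak\<close> removes the
      diagonal.\<close>
    have "x \<noteq> y"
      using that by (auto simp: R2_def seq_prec_def seq_weak_def before_def not_later_def Let_def)
    then have "(x, y) \<in> cl_weak (occs s) R3 R2"
      using that by (auto simp: cl_weak_def star_on_def)
    then show ?thesis
      using ext by (auto simp: weak_of_def simp del: split_paired_All)
  qed
  show "(x, y) \<in> seq_inl inl s \<Longrightarrow> (x, y) \<in> P \<or> (y, x) \<in> P"
    using R1 by (simp add: R1_def)
  show "(x, y) \<in> seq_weak ser inl s \<Longrightarrow> (y, x) \<notin> P"
    using R2 by (simp add: R2_def)
  show "(x, y) \<in> seq_prec ser inl s \<Longrightarrow> (x, y) \<in> P"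
    using R1 [of x y] R2 [of x y] by (auto simp: R1_def R2_def)
qed

lemma cong_extension:
  assumes s: "s \<in> step_seqs E sim" and ext: "(X, P) \<in> strat_ext (seq_structure ser inl s)"
  shows "s \<approx> level_seq fst (\<lambda>x. card {z. (z, x) \<in> P}) X"
proof -
  \<comment> \<open>Here \<open>p\<close> ranks occurrences by the steps of \<open>s\<close>,
    \<open>q\<close> by the levels of \<open>P\<close>, and the classes of the preorder
    \<open>W\<close> are the components.\<close>
  define p where "p = pos s"
  define q where "q = (\<lambda>x. card {z. (z, x) \<in> P})"
  define W where "W = star_on X (seq_weak ser inl s)"
  have X: "X = occs s" and strat: "stratified_order_on X P"
    using strat_ext_seq_structureD [OF ext] by auto
  have fin: "finite X"
    using X s finite_occs by simp
  have q_iff: "(x, y) \<in> P \<longleftrightarrow> q x < q y" if "x \<in> X" "y \<in> X" for x y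
    unfolding q_def using stratified_order_rank [OF strat fin that] .

  have inl_q: "q x \<noteq> q y" if "(fst x, fst y) \<in> inl" "x \<in> X" "y \<in> X" for x y
    using that strat_ext_seq_structureD(3) [OF ext, of x y] q_iff X by (auto simp: seq_inl_def)
  have weakI: "(x, y) \<in> seq_weak ser inl s"
    if "x \<noteq> y" "x \<in> X" "y \<in> X" "p x \<le> p y" "(fst y, fst x) \<notin> ser \<union> inl" for x y
    using that by (simp add: seq_weak_def not_later_def X p_def)
  have weakD: "x \<in> X \<and> y \<in> X \<and> p x \<le> p y \<and> q x \<le> q y" if "(x, y) \<in> seq_weak ser inl s" for x y
  proof -
    have "x \<in> X \<and> y \<in> X \<and> p x \<le> p y"
      using that by (simp add: seq_weak_def not_later_def X p_def)
    then show ?thesis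
      using strat_ext_seq_structureD(4) [OF ext that] q_iff [of y x] by simp
  qed
  have prec_q: "q x < q y" if "x \<in> X" "y \<in> X" "p x < p y" "(fst x, fst y) \<notin> ser \<union> inl" for x y
    using that q_iff strat_ext_seq_structureD(5) [OF ext, of x y]
    by (simp add: seq_prec_def before_def X p_def Let_def)
  \<comment> \<open>Clause (ii) of \<open>seq_prec\<close>: one pair outside \<open>inl\<close>
    between the \<open>W\<close>-classes of \<open>x\<close> and \<open>y\<close> fixes their order
    in \<open>P\<close>.\<close>
  have prec_inl_q: "q x < q y"
    if "x \<in> X" "y \<in> X" "p x < p y" "(fst x, fst y) \<in> inl"
      "(x, x') \<in> W" "(x', x) \<in> W" "(y, y') \<in> W" "(y', y) \<in> W"
      "x' \<in> X" "y' \<in> X" "(fst x', fst y') \<notin> inl" for x y x' y'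
  proof -
    have "(x, y) \<in> sym_part W O compl_on X (seq_inl inl s) O sym_part W"
      using that by (auto simp: sym_part_def compl_on_def seq_inl_def)
    then have "(x, y) \<in> seq_prec ser inl s"
      using that by (simp add: seq_prec_def before_def seq_inl_def X p_def W_def Let_def)
    then show ?thesis
      using that q_iff strat_ext_seq_structureD(5) [OF ext, of x y] by simp
  qed

  \<comment> \<open>Both ranks are monotone along \<open>W\<close>, so a class of \<open>W\<close>
    lies in one step of \<open>s\<close> and in one level of \<open>P\<close>.\<close>
  have W: "x \<in> X \<and> y \<in> X \<and> p x \<le> p y \<and> q x \<le> q y" if "(x, y) \<in> W" for x y
  proof -
    have "x \<in> X \<and> y \<in> X \<and> p x \<le> p y \<and> q x \<le> q y" if "(x, y) \<in> (seq_weak ser inl s)\<^sup>+"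
      using that
    proof (induction rule: trancl_induct)
      case (base y)
      then show ?case
        by (rule weakD)
    next
      case (step y z)
      then show ?case
        using weakD [of y z] by auto
    qed
    then show ?thesis
      using that by (auto simp: W_def star_on_def)
  qed
  have weak_W: "(x, y) \<in> W" if "(x, y) \<in> seq_weak ser inl s" for x y
    using that by (auto simp: W_def star_on_def)
  have trans_W: "trans W"
    by (auto simp: W_def star_on_def trans_def dest: trancl_trans)
  have refl_W: "\<forall>x\<in>X. (x, x) \<in> W"
    by (simp add: W_def star_on_def Id_on_iff)
  have mono_W: "\<forall>(x, y)\<in>W. p x \<le> p y"
    using W by blast
  \<comment> \<open>The ties of \<open>f\<close> are exactly the classes of \<open>W\<close>, listed
    step by step and, within a step, compatibly with \<open>W\<close>.\<close>
  obtain f :: "'e occ \<Rightarrow> nat" where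
    f: "\<forall>x\<in>X. \<forall>y\<in>X. (p x < p y \<longrightarrow> f x < f y) \<and> ((x, y) \<in> W \<longrightarrow> f x \<le> f y) \<and> (f x = f y \<longrightarrow> (x, y) \<in> W)"
    using ex_preorder_rank [OF fin refl_W trans_W mono_W] by blast
  have f_p: "p x \<le> p y" if "f x \<le> f y" "x \<in> X" "y \<in> X" for x y
    using f that by (meson not_le)
  have f_W: "(x, y) \<in> W" if "f x = f y" "x \<in> X" "y \<in> X" for x y
    using f that by blast
  \<comment> \<open>Otherwise the reversed pair is in \<open>seq_weak\<close>, which forces
    \<open>f y \<le> f x\<close>.\<close>
  have f_ser_inl: "(fst x, fst y) \<in> ser \<union> inl" if "f x < f y" "p y \<le> p x" "x \<in> X" "y \<in> X" for x y
  proof (rule ccontr)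
    assume "(fst x, fst y) \<notin> ser \<union> inl"
    moreover have "y \<noteq> x"
      using that by blast
    ultimately have "(y, x) \<in> W"
      using that weakI weak_W by blast
    then show False
      using that f by (meson not_le)
  qed
  obtain g :: "'e occ \<Rightarrow> nat" where
    g: "\<forall>x\<in>X. \<forall>y\<in>X. g x < g y \<longleftrightarrow> q x < q y \<or> q x = q y \<and> f x < f y"
    using ex_lex_rank [OF fin, of q f] by auto
  \<comment> \<open>The rank \<open>q\<close> is constant on each class of \<open>W\<close>, so
    \<open>g\<close> has the same ties as \<open>f\<close>.\<close>
  have g_f: "f x = f y \<longleftrightarrow> g x = g y" if "x \<in> X" "y \<in> X" for x y
  proof
    assume "f x = f y"
    then have "q x = q y"
      using that f_W [of x y] f_W [of y x] W by (simp add: eq_iff)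
    then show "g x = g y"
      using g that \<open>f x = f y\<close> by (metis less_irrefl linorder_neqE_nat)
  next
    assume "g x = g y"
    then show "f x = f y"
      using g that by (metis less_irrefl linorder_neqE_nat)
  qed

  have p_levels: "step_levels fst p X"
    using step_levels_pos [OF s] by (simp add: p_def X)
  have p_inl: "(fst x, fst y) \<notin> inl" if "p x = p y" "x \<in> X" "y \<in> X" for x y
  proof (cases "fst x = fst y")
    case False
    then have "(fst x, fst y) \<in> sim"
      using p_levels that by (simp add: step_levels_def)
    then show ?thesis
      using sim_inl_disjoint by blast
  qed (use irrefl_inl in \<open>simp add: irrefl_def\<close>)
  have f_levels: "step_levels fst f X"
  proof -
    have "p x = p y" if "f x = f y" "x \<in> X" "y \<in> X" for x y
      using f_p [of x y] f_p [of y x] that by simp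
    then show ?thesis
      using p_levels unfolding step_levels_def by blast
  qed
  \<comment> \<open>Labels in \<open>inl\<close> would put \<open>x\<close> and \<open>y\<close> in
    different levels. If they are not in \<open>ser\<close> either, clause (i) applies when
    \<open>p x < p y\<close>, and \<open>f_ser_inl\<close> otherwise.\<close>
  have q_ser: "(fst x, fst y) \<in> ser" if "q x = q y" "f x < f y" "x \<in> X" "y \<in> X" for x y
  proof (rule ccontr)
    assume "(fst x, fst y) \<notin> ser"
    then have "(fst x, fst y) \<notin> ser \<union> inl"
      using inl_q that by blast
    then show False
      using prec_q [of x y] f_ser_inl [of x y] that by fastforce
  qed
  \<comment> \<open>Within a level of \<open>P\<close>, labels from different classes are in
    \<open>ser\<close> in one direction, hence in \<open>sim\<close>, and each class lies inside a
    step of \<open>s\<close>.\<close>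
  have q_levels: "step_levels fst q X"
    unfolding step_levels_def
  proof (intro conjI ballI impI)
    show "fst ` X \<subseteq> E"
      using p_levels by (simp add: step_levels_def)
    fix x y assume xy: "x \<in> X" "y \<in> X" "q x = q y" "fst x \<noteq> fst y"
    consider "f x < f y" | "f y < f x" | "f x = f y"
      by linarith
    then show "(fst x, fst y) \<in> sim"
    proof cases
      case 1
      then show ?thesis
        using q_ser [of x y] xy ser_sub by auto
    next
      case 2
      then have "(fst y, fst x) \<in> sim"
        using q_ser [of y x] xy ser_sub by auto
      then show ?thesis
        using sym_sim by (rule symD [rotated])
    next
      case 3
      then show ?thesis
        using f_levels xy by (simp add: step_levels_def)
    qed
  qed

  \<comment> \<open>The chain of congruences through the ranks \<open>p\<close>, \<open>f\<close>,
    \<open>g\<close>, \<open>q\<close>\<close>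
  have "s = level_seq fst p X"
    using level_seq_pos [OF s] by (simp add: p_def X)
  also have "level_seq fst p X \<approx> level_seq fst f X"
  proof (rule cong_level_seq_refine [OF fin p_levels])
    show "\<forall>x\<in>X. \<forall>y\<in>X. p x = p y \<longrightarrow> f x < f y \<longrightarrow> (fst x, fst y) \<in> ser"
      using f_ser_inl p_inl by fastforce
  qed (use f in blast)
  also \<comment> \<open>Ties of \<open>q\<close> are broken by \<open>f\<close>, so only components in different levels of \<open>P\<close> are interchanged.\<close>
  have "level_seq fst f X \<approx> level_seq fst g X"
  proof (rule cong_level_seq_permute [OF fin f_levels])
    show "\<forall>x\<in>X. \<forall>y\<in>X. f x < f y \<longrightarrow> g y < g x \<longrightarrow>
        swappable (fst ` {z \<in> X. f z = f x}) (fst ` {z \<in> X. f z = f y})"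
    proof (intro ballI impI)
      fix x y assume xy: "x \<in> X" "y \<in> X" "f x < f y" "g y < g x"
      define A B where "A = {z \<in> X. f z = f x}" and "B = {z \<in> X. f z = f y}"
      have AB: "a \<in> X \<and> b \<in> X \<and> f a < f b \<and> p a \<le> p b \<and> q b < q a" if "a \<in> A" "b \<in> B" for a b
      proof -
        have ab: "a \<in> X" "b \<in> X" "f a < f b"
          using that xy by (auto simp: A_def B_def)
        have "g a = g x" "g b = g y"
          using that xy g_f [of a x] g_f [of b y] by (simp_all add: A_def B_def)
        \<comment> \<open>With a tie in \<open>q\<close>, \<open>g\<close> would order
          \<open>a\<close> and \<open>b\<close> as \<open>f\<close> does.\<close>
        then have "q b < q a"
          using g ab xy(4) by (metis less_asym)
        then show ?thesis
          using ab f_p [of a b] by simp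
      qed
      \<comment> \<open>If the pair from \<open>b\<close> to \<open>a\<close> failed,
        \<open>a\<close> would be weakly before \<open>b\<close> in \<open>P\<close>. If the pair
        from \<open>a\<close> to \<open>b\<close> failed, clause (i) would apply for
        \<open>p a < p b\<close>, and \<open>f_ser_inl\<close> for equal positions.\<close>
      have ser_inl: "(fst a, fst b) \<in> ser \<union> inl \<and> (fst b, fst a) \<in> ser \<union> inl" if "a \<in> A" "b \<in> B" for a b
      proof
        note ab = AB [OF that]
        show "(fst b, fst a) \<in> ser \<union> inl"
          using ab weakI [of a b] weakD [of a b] by fastforce
        show "(fst a, fst b) \<in> ser \<union> inl"
          using ab prec_q [of a b] f_ser_inl [of a b] by fastforce
      qed
      \<comment> \<open>A single \<open>inl\<close> pair forces all pairs into \<open>inl\<close>: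
        its members lie in different steps, so with a pair outside \<open>inl\<close> clause (ii)
        would put \<open>a\<close> before \<open>b\<close> in \<open>P\<close>.\<close>
      have "fst ` A \<times> fst ` B \<subseteq> inl" if ab: "a \<in> A" "b \<in> B" "(fst a, fst b) \<in> inl" for a b
      proof (rule ccontr)
        assume "\<not> fst ` A \<times> fst ` B \<subseteq> inl"
        then obtain a' b' where a'b': "a' \<in> A" "b' \<in> B" "(fst a', fst b') \<notin> inl"
          by auto
        have "p a < p b"
          using AB [OF ab(1,2)] p_inl [of a b] ab(3) by (auto simp: order_le_less)
        moreover have "(a, a') \<in> W" "(a', a) \<in> W" "(b, b') \<in> W" "(b', b) \<in> W"
          using ab a'b' by (auto simp: A_def B_def intro!: f_W)
        ultimately have "q a < q b"
          using prec_inl_q [of a b a' b'] AB [OF ab(1,2)] AB [OF a'b'(1,2)] ab(3) a'b'(3) by simp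
        then show False
          using AB [OF ab(1,2)] by simp
      qed
      moreover have "fst ` A \<times> fst ` B \<subseteq> ser \<and> fst ` B \<times> fst ` A \<subseteq> ser"
        if no_inl: "\<forall>a\<in>A. \<forall>b\<in>B. (fst a, fst b) \<notin> inl"
      proof -
        have "(fst b, fst a) \<notin> inl" if "a \<in> A" "b \<in> B" for a b
          using no_inl that symD [OF sym_inl] by blast
        then show ?thesis
          using no_inl ser_inl by blast
      qed
      ultimately show "swappable (fst ` A) (fst ` B)"
        unfolding swappable_def by blast
    qed
  qed (use g_f in blast)
  also have "level_seq fst g X \<approx> level_seq fst q X"
  \<comment> \<open>It is \<open>g\<close> that refines \<open>q\<close>, so the splitting is read
    backwards to merge components into levels of \<open>P\<close>.\<close>
  proof (rule cong_sym, rule cong_level_seq_refine [OF fin q_levels])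
    show "\<forall>x\<in>X. \<forall>y\<in>X. q x = q y \<longrightarrow> g x < g y \<longrightarrow> (fst x, fst y) \<in> ser"
      using g q_ser by (metis less_irrefl)
  qed (use g in blast)
  finally show ?thesis
    by (simp add: q_def)
qed

end

theorem theorem11p5:
  fixes E :: "'e set" and sim ser inl :: "'e rel" and s t :: "'e set list"
  assumes "g_comtrace_alphabet E sim ser inl"
    and "s \<in> step_seqs E sim"
    and "t \<in> step_seqs E sim"
    and "strat_ext (seq_structure ser inl s) \<inter> strat_ext (seq_structure ser inl t) \<noteq> {}"
  shows "(s, t) \<in> g_congruence E sim ser inl"
proof -
  interpret g_comtrace_alphabet E sim ser inl
    by fact
  obtain X P where "(X, P) \<in> strat_ext (seq_structure ser inl s)" "(X, P) \<in> strat_ext (seq_structure ser inl t)"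
    using assms(4) by (metis IntE all_not_in_conv prod.exhaust)
  then have "s \<approx> t"
    using assms(2,3) cong_extension [of _ X P] cong_sym cong_trans by blast
  then show ?thesis
    by (simp add: cong_def)
qed

end
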